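(* Let $D_1$ and $D_2$ be two digraphs on $n_1$ and $n_2$ vertices, and $m_1$ and $m_2$ arcs, respectively. Suppose that $D_1$ is $r$-out-regular. Then (1) $$f_{L(D_1\mathbin{\underline{\vee}} D_2)}(\lambda)=(-1)^{n_1}(\lambda-1-n_2)^{n_1(r-1)}\,f_{L(D_2)}(\lambda-n_1r)\,f_{L(D_1)}\bigl(r-(\lambda-r)(\lambda-1-n_2)\bigr)\left[1-\frac{r(\lambda-r)n_1n_2}{(\lambda-n_1r)\bigl((\lambda-r)(\lambda-1-n_2)-r\bigr)}\right],$$ (2) $$f_{Q(D_1\mathbin{\underline{\vee}} D_2)}(\lambda)=(\lambda-1-n_2)^{n_1(r-1)}\,f_{Q(D_2)}(\lambda-n_1r)\,f_{Q(D_1)}\bigl(r+(\lambda-r)(\lambda-1-n_2)\bigr)\left[1-\frac{n_1r(\lambda-r)\,\chi_{Q(D_2)}(\lambda-n_1r)}{(\lambda-r)(\lambda-1-n_2)-r}\right].$$ In particular, the $L$-spectrum of $D_1\mathbin{\underline{\vee}} D_2$ is completely determined by the $L$-spectra of $D_1$ and $D_2$, and the $Q$-spectrum of $D_1\mathbin{\underline{\vee}} D_2$ is completely determined by the $Q$-spectra of $D_1$ and $D_2$, and the $Q$-coronal of $D_2$.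
   Context: Digraphs are finite, have at least one vertex, and are simple (no loops, no multiple arcs), but both arcs $uv$ and $vu$ may be present. The adjacency matrix $A(D)=[a_{ij}]$ has $a_{ij}=1$ if $v_iv_j$ is an arc and $0$ otherwise; $D_{\mathrm{out}}(D)$ is the diagonal matrix of out-degrees; $L(D)=D_{\mathrm{out}}(D)-A(D)$ is the Laplacian matrix and $Q(D)=D_{\mathrm{out}}(D)+A(D)$ the signless Laplacian matrix. $D$ is $r$-out-regular if every vertex has out-degree $r$. For an $n\times n$ real matrix $M$, $f_M(\lambda)=\det(\lambda I_n-M)$ and the coronal is $\chi_M(\lambda)=\mathbf 1_n^T(\lambda I_n-M)^{-1}\mathbf 1_n\in\mathbb C(\lambda)$, where $\mathbf 1_n$ is the all-ones column vector. The $L$-spectrum (resp. $Q$-spectrum) of $D$ is the multiset of roots of $f_{L(D)}$ (resp. $f_{Q(D)}$); the $Q$-coronal of $D$ is $\chi_{Q(D)}$. Identities are in $\mathbb C(\lambda)$. "Completely determined by" certain data means that (for $D_1$ ranging over out-regular digraphs) equal data yield equal spectra. The subdivision digraph $\mathcal S(D)$ is obtained from $D$ by replacing each arc $uv$ by a directed path $u\to w\to v$ of length two through a new vertex $w$ (one new vertex per arc); $I(D)$ denotes the set of new vertices. The subdivision-arc join $D_1\mathbin{\underline{\vee}} D_2$ is obtained from the disjoint union of $\mathcal S(D_1)$ and $D_2$ by adding both arcs $vw$ and $wv$ for every new vertex $v\in I(D_1)$ and every $w\in V(D_2)$. *)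

theory Defs
  imports
    "Graph_Theory.Graph_Theory"
    "Jordan_Normal_Form.Char_Poly"
    "Jordan_Normal_Form.Gauss_Jordan_Elimination"
    "HOL-Computational_Algebra.Computational_Algebra"
    "HOL-Computational_Algebra.Field_as_Ring"
begin

section \<open>Digraphs\<close>

definition simple_digraph :: "'a pair_pre_digraph \<Rightarrow> bool" where
  "simple_digraph D \<longleftrightarrow> pair_digraph D \<and> pverts D \<noteq> {}"

definition out_regular :: "nat \<Rightarrow> 'a pair_pre_digraph \<Rightarrow> bool" where
  "out_regular r D \<longleftrightarrow> (\<forall>v \<in> pverts D. out_degree (with_proj D) v = r)"

text \<open>The new vertex on the arc \<open>uv\<close> is \<open>Inr (u, v)\<close>.\<close>

definition new_vertices :: "'a pair_pre_digraph \<Rightarrow> ('a + 'a \<times> 'a) set" where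
  "new_vertices D = Inr ` parcs D"

definition subdivision_digraph ::
    "'a pair_pre_digraph \<Rightarrow> ('a + 'a \<times> 'a) pair_pre_digraph" where
  "subdivision_digraph D =
     \<lparr> pverts = Inl ` pverts D \<union> new_vertices D,
       parcs = (\<Union>(u, v) \<in> parcs D. {(Inl u, Inr (u, v)), (Inr (u, v), Inl v)}) \<rparr>"

definition subdivision_arc_join ::
    "'a pair_pre_digraph \<Rightarrow> 'b pair_pre_digraph \<Rightarrow> (('a + 'a \<times> 'a) + 'b) pair_pre_digraph" where
  "subdivision_arc_join D1 D2 =
     \<lparr> pverts = pverts (subdivision_digraph D1) <+> pverts D2,
       parcs = map_prod Inl Inl ` parcs (subdivision_digraph D1)
             \<union> map_prod Inr Inr ` parcs D2
             \<union> (\<Union>v \<in> new_vertices D1. \<Union>w \<in> pverts D2. {(Inl v, Inr w), (Inr w, Inl v)}) \<rparr>"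

lemma simple_digraph_subdivision_arc_join:
  assumes "simple_digraph D1" "simple_digraph D2"
  shows "simple_digraph (subdivision_arc_join D1 D2)"
proof -
  interpret D1: pair_digraph D1 using assms(1) by (simp add: simple_digraph_def)
  interpret D2: pair_digraph D2 using assms(2) by (simp add: simple_digraph_def)
  show ?thesis
    unfolding simple_digraph_def
  proof
    show "pair_digraph (subdivision_arc_join D1 D2)"
    proof
      fix e assume e: "e \<in> parcs (subdivision_arc_join D1 D2)"
      show "fst e \<in> pverts (subdivision_arc_join D1 D2)"
        using e D1.in_arcsD1 D2.in_arcsD1
        by (fastforce simp: subdivision_arc_join_def subdivision_digraph_def new_vertices_def)
      show "snd e \<in> pverts (subdivision_arc_join D1 D2)"
        using e D1.in_arcsD2 D2.in_arcsD2
        by (fastforce simp: subdivision_arc_join_def subdivision_digraph_def new_vertices_def)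
      show "fst e \<noteq> snd e"
        using e D2.pair_no_loops
        by (fastforce simp: subdivision_arc_join_def subdivision_digraph_def new_vertices_def)
    next
      show "finite (pverts (subdivision_arc_join D1 D2))"
        by (simp add: subdivision_arc_join_def subdivision_digraph_def new_vertices_def
            D1.pair_finite_verts D2.pair_finite_verts D1.pair_finite_arcs)
      show "finite (parcs (subdivision_arc_join D1 D2))"
        by (auto simp: subdivision_arc_join_def subdivision_digraph_def new_vertices_def
            D1.pair_finite_arcs D2.pair_finite_verts D2.pair_finite_arcs)
    qed
    show "pverts (subdivision_arc_join D1 D2) \<noteq> {}"
      using assms by (auto simp: simple_digraph_def subdivision_arc_join_def)
  qed
qed

section \<open>Matrices of a digraph\<close>

text \<open>
  The matrices depend on a numbering of the vertices, given here as a list \<open>vs\<close> whose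
  \<open>i\<close>-th entry is the vertex with index \<open>i\<close> (counting from 0).
\<close>

definition vertex_ordering :: "'a list \<Rightarrow> 'a pair_pre_digraph \<Rightarrow> bool" where
  "vertex_ordering vs D \<longleftrightarrow> distinct vs \<and> set vs = pverts D"

definition adjacency_matrix :: "'a list \<Rightarrow> 'a pair_pre_digraph \<Rightarrow> real mat" where
  "adjacency_matrix vs D =
     mat (length vs) (length vs) (\<lambda>(i, j). if (vs ! i, vs ! j) \<in> parcs D then 1 else 0)"

definition out_degree_matrix :: "'a list \<Rightarrow> 'a pair_pre_digraph \<Rightarrow> real mat" where
  "out_degree_matrix vs D =
     mat_diag (length vs) (\<lambda>i. real (out_degree (with_proj D) (vs ! i)))"

definition laplacian_matrix :: "'a list \<Rightarrow> 'a pair_pre_digraph \<Rightarrow> real mat" where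
  "laplacian_matrix vs D = out_degree_matrix vs D - adjacency_matrix vs D"

definition signless_laplacian_matrix :: "'a list \<Rightarrow> 'a pair_pre_digraph \<Rightarrow> real mat" where
  "signless_laplacian_matrix vs D = out_degree_matrix vs D + adjacency_matrix vs D"

section \<open>Characteristic polynomial, spectrum and coronal\<close>

definition charpoly :: "real mat \<Rightarrow> complex poly" where
  "charpoly M = char_poly (map_mat complex_of_real M)"

definition spectrum_mset :: "real mat \<Rightarrow> complex multiset" where
  "spectrum_mset M = proots (charpoly M)"

text \<open>
  The field of rational functions is \<^typ>\<open>complex poly fract\<close>. The matrix
  \<^term>\<open>char_poly_matrix M\<close> is \<open>\<lambda>I - M\<close> over the polynomials; over the rational functions
  it is invertible, its determinant being monic, so \<^const>\<open>mat_inverse\<close> never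
  returns \<^term>\<open>None\<close> below when \<open>M\<close> is square.
\<close>

definition coronal :: "real mat \<Rightarrow> complex poly fract" where
  "coronal M =
     (let one = vec (dim_row M) (\<lambda>_. 1);
          R = map_mat to_fract (char_poly_matrix (map_mat complex_of_real M))
      in one \<bullet> (the (mat_inverse R) *\<^sub>v one))"

definition lam :: "complex poly fract" where
  "lam = to_fract [:0, 1:]"

text \<open>Substitution of a rational function for the indeterminate.\<close>

definition subst_poly :: "complex poly \<Rightarrow> complex poly fract \<Rightarrow> complex poly fract" where
  "subst_poly p x = poly (map_poly (\<lambda>c. to_fract [:c:]) p) x"

text \<open>
  The denominator can only vanish after substitution if \<open>x\<close> is a constant.
\<close>

definition subst_ratfun ::
    "complex poly fract \<Rightarrow> complex poly fract \<Rightarrow> complex poly fract" where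
  "subst_ratfun q x =
     (case quot_of_fract q of (a, b) \<Rightarrow> subst_poly a x / subst_poly b x)"

end

theory Submission
  imports Defs "Jordan_Normal_Form.Schur_Decomposition"
begin

text \<open>
  Both formulas are one computation with a determinant. For \<open>s = -1\<close> (Laplacian) and \<open>s = 1\<close>
  (signless Laplacian) the matrix of the join has the block of the new vertices equal to a scalar
  matrix, so these vertices can be eliminated. The product of the two incidence matrices of arcs
  with their tails and heads is the adjacency matrix of \<open>D\<^sub>1\<close>, and since \<open>D\<^sub>1\<close> is out-regular, the
  block with rows in \<open>D\<^sub>1\<close> and columns in \<open>D\<^sub>2\<close> becomes constant, while the all-ones vector is an
  eigenvector of the block of \<open>D\<^sub>1\<close>. A second elimination therefore separates the two digraphs at
  the price of subtracting a constant from every entry of the block of \<open>D\<^sub>2\<close>. The matrix determinant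
  lemma splits this off as the bracket in the formulas, where the coronal enters. This is
  \<open>det_join\<close>, proved over an arbitrary field with the elimination lemmas \<open>det_on_eliminate_lower\<close>,
  \<open>det_on_eliminate_upper\<close> and the determinant lemma \<open>det_on_minus_constant\<close>.

  The formulas in rational functions follow because substitution commutes with determinants
  (\<open>subst_poly_charpoly\<close>) and, at a shifted indeterminate, is a homomorphism of fields, hence also
  commutes with solving linear systems (\<open>subst_coronal_as_solution\<close>). For the Laplacian the linear
  system has a constant solution, because the rows of a Laplacian matrix sum to zero.

  The spectra determine the characteristic polynomials, which are monic, and thereby the right-hand
  sides, once the out-degree \<open>r\<close> is known. The trace supplies it: the eigenvalues of
  either matrix of \<open>D\<^sub>1\<close> add up to the number \<open>n\<^sub>1 r\<close> of arcs, and there is at least one vertex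
  (\<open>spectrum_determines_out_degree\<close>).
\<close>

section \<open>Determinants indexed by finite sets\<close>

definition list_mat :: "('a \<Rightarrow> 'b \<Rightarrow> 'c) \<Rightarrow> 'a list \<Rightarrow> 'b list \<Rightarrow> 'c mat" where
  "list_mat f xs ys = mat (length xs) (length ys) (\<lambda>(i, j). f (xs ! i) (ys ! j))"

lemma list_mat_carrier [simp]: "list_mat f xs ys \<in> carrier_mat (length xs) (length ys)"
  by (simp add: list_mat_def)

lemma list_mat_cong:
  assumes "\<And>u v. u \<in> set xs \<Longrightarrow> v \<in> set ys \<Longrightarrow> f u v = g u v"
  shows "list_mat f xs ys = list_mat g xs ys"
  using assms by (auto simp: list_mat_def intro!: eq_matI)

lemma list_mat_map: "list_mat f (map g xs) (map h ys) = list_mat (\<lambda>u v. f (g u) (h v)) xs ys"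
  by (auto simp: list_mat_def intro!: eq_matI)

lemma list_mat_append:
  "list_mat f (xs @ ys) (xs' @ ys') =
    four_block_mat (list_mat f xs xs') (list_mat f xs ys') (list_mat f ys xs') (list_mat f ys ys')"
  by (rule eq_matI) (auto simp: list_mat_def nth_append)

lemma list_mat_add: "list_mat f xs ys + list_mat g xs ys = list_mat (\<lambda>u v. f u v + g u v) xs ys"
  by (auto simp: list_mat_def intro!: eq_matI)

lemma list_mat_mult:
  fixes f :: "'a \<Rightarrow> 'b \<Rightarrow> 'k :: comm_semiring_0"
  assumes "distinct ys"
  shows "list_mat f xs ys * list_mat g ys zs = list_mat (\<lambda>u v. \<Sum>w\<in>set ys. f u w * g w v) xs zs"
proof (rule eq_matI)
  fix i j assume "i < dim_row (list_mat (\<lambda>u v. \<Sum>w\<in>set ys. f u w * g w v) xs zs)"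
    and "j < dim_col (list_mat (\<lambda>u v. \<Sum>w\<in>set ys. f u w * g w v) xs zs)"
  then have i: "i < length xs" and j: "j < length zs" by (auto simp: list_mat_def)
  have "(\<Sum>k<length ys. f (xs ! i) (ys ! k) * g (ys ! k) (zs ! j)) =
      (\<Sum>w\<in>set ys. f (xs ! i) w * g w (zs ! j))"
    by (rule sum.reindex_bij_betw[OF bij_betw_nth[OF assms refl refl]])
  with i j show "(list_mat f xs ys * list_mat g ys zs) $$ (i, j) =
      list_mat (\<lambda>u v. \<Sum>w\<in>set ys. f u w * g w v) xs zs $$ (i, j)"
    by (simp add: list_mat_def scalar_prod_def atLeast0LessThan)
qed (auto simp: list_mat_def)

text \<open>The sign of the permutation occurs once for the rows and once for the columns, and
  its square is one.\<close>

lemma det_permute_rows_cols: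
  fixes M :: "'k :: comm_ring_1 mat"
  assumes M: "M \<in> carrier_mat n n" and p: "p permutes {0..<n}"
  shows "det (mat n n (\<lambda>(i, j). M $$ (p i, p j))) = det M"
proof -
  define B where "B = mat n n (\<lambda>(i, j). M $$ (p i, j))"
  define C where "C = mat n n (\<lambda>(i, j). transpose_mat B $$ (p i, j))"
  have B: "B \<in> carrier_mat n n" and C: "C \<in> carrier_mat n n" by (auto simp: B_def C_def)
  have pn: "p i < n" if "i < n" for i using permutes_in_image[OF p, of i] that by simp
  have "mat n n (\<lambda>(i, j). M $$ (p i, p j)) = transpose_mat C"
    by (rule eq_matI) (auto simp: B_def C_def pn)
  then have "det (mat n n (\<lambda>(i, j). M $$ (p i, p j))) = det C"
    using det_transpose[OF C] by simp
  also have "\<dots> = signof p * det (transpose_mat B)"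
    unfolding C_def by (rule det_permute_rows) (use B p in auto)
  also have "det (transpose_mat B) = det B" by (rule det_transpose[OF B])
  also have "det B = signof p * det M" unfolding B_def by (rule det_permute_rows[OF M p])
  also have "signof p * (signof p * det M) = det M"
    by (cases p rule: sign_cases) simp_all
  finally show ?thesis .
qed

lemma det_list_mat_reorder:
  fixes f :: "'a \<Rightarrow> 'a \<Rightarrow> 'k :: comm_ring_1"
  assumes "distinct xs" "distinct ys" "set xs = set ys"
  shows "det (list_mat f xs xs) = det (list_mat f ys ys)"
proof -
  have "mset xs = mset ys" using assms by (simp add: set_eq_iff_mset_eq_distinct)
  then obtain p where p: "p permutes {..<length ys}" "permute_list p ys = xs"
    by (rule mset_eq_permutation)
  have len: "length xs = length ys" using \<open>mset xs = mset ys\<close> by (metis size_mset)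
  have nth: "xs ! i = ys ! p i" and "p i < length ys" if "i < length ys" for i
    using permute_list_nth[OF p(1) that] p(2) permutes_in_image[OF p(1), of i] that by auto
  then have "list_mat f xs xs =
      mat (length ys) (length ys) (\<lambda>(i, j). list_mat f ys ys $$ (p i, p j))"
    by (intro eq_matI) (auto simp: list_mat_def len)
  then show ?thesis
    using det_permute_rows_cols[of "list_mat f ys ys" "length ys" p] p(1)
    by (simp add: atLeast0LessThan)
qed

text \<open>
  Any enumeration of the finite set \<open>S\<close> gives the same value, by the previous lemma. Indexing by
  a set lets a determinant be split along a partition of the vertices of a digraph without
  committing to an ordering in which the parts are contiguous.
\<close>

definition det_on :: "'a set \<Rightarrow> ('a \<Rightarrow> 'a \<Rightarrow> 'k :: comm_ring_1) \<Rightarrow> 'k" where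
  "det_on S f = (let xs = (SOME xs. distinct xs \<and> set xs = S) in det (list_mat f xs xs))"

lemma det_on_eq:
  assumes "distinct xs" "set xs = S"
  shows "det_on S f = det (list_mat f xs xs)"
proof -
  define ys where "ys = (SOME xs. distinct xs \<and> set xs = S)"
  have "distinct ys \<and> set ys = S"
    unfolding ys_def by (rule someI[of _ xs]) (use assms in simp)
  then show ?thesis
    using det_list_mat_reorder[of ys xs f] assms by (simp add: det_on_def ys_def Let_def)
qed

lemma det_on_cong:
  assumes "finite S" "\<And>u v. u \<in> S \<Longrightarrow> v \<in> S \<Longrightarrow> f u v = g u v"
  shows "det_on S f = det_on S g"
proof -
  obtain xs where "distinct xs" "set xs = S" using finite_distinct_list[OF assms(1)] by auto
  then show ?thesis using assms(2) list_mat_cong[of xs xs f g] by (simp add: det_on_eq)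
qed

lemma det_on_image:
  assumes "finite S" "inj_on h S"
  shows "det_on (h ` S) f = det_on S (\<lambda>u v. f (h u) (h v))"
proof -
  obtain xs where xs: "distinct xs" "set xs = S" using finite_distinct_list[OF assms(1)] by auto
  then have "det_on (h ` S) f = det (list_mat f (map h xs) (map h xs))"
    by (intro det_on_eq) (use assms in \<open>auto simp: distinct_map\<close>)
  then show ?thesis using xs by (simp add: list_mat_map det_on_eq)
qed

lemma det_on_scale:
  assumes "finite S"
  shows "det_on S (\<lambda>u v. c * f u v) = c ^ card S * det_on S f"
proof -
  obtain xs where xs: "distinct xs" "set xs = S" using finite_distinct_list[OF assms(1)] by auto
  have "list_mat (\<lambda>u v. c * f u v) xs xs = c \<cdot>\<^sub>m list_mat f xs xs"
    by (auto simp: list_mat_def intro!: eq_matI)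
  then show ?thesis using xs distinct_card[of xs] by (simp add: det_on_eq det_smult list_mat_def)
qed

lemma det_on_diagonal:
  assumes "finite S"
  shows "det_on S (\<lambda>u v. if u = v then c else 0) = c ^ card S"
proof -
  obtain xs where xs: "distinct xs" "set xs = S" using finite_distinct_list[OF assms(1)] by auto
  have "list_mat (\<lambda>u v. if u = v then c else 0) xs xs = c \<cdot>\<^sub>m 1\<^sub>m (length xs)"
    using xs by (auto simp: list_mat_def nth_eq_iff_index_eq intro!: eq_matI)
  then show ?thesis using xs distinct_card[of xs] by (simp add: det_on_eq det_smult)
qed

lemma det_on_singleton: "det_on {u} f = f u u"
  by (subst det_on_eq[of "[u]"]) (auto simp: list_mat_def det_single)

text \<open>
  Block elimination: multiplying on the right by a block-unitriangular matrix, of determinant one,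
  clears an off-diagonal block. The multiplier \<open>K\<close> is left to the user, so that no inverse of a
  block has to be formed; in the applications \<open>K\<close> can be written down explicitly.
\<close>

lemma det_four_block_eliminate_lower:
  fixes P :: "'k :: idom mat"
  assumes P: "P \<in> carrier_mat n n" and Q: "Q \<in> carrier_mat n m"
    and R: "R \<in> carrier_mat m n" and T: "T \<in> carrier_mat m m"
    and K: "K \<in> carrier_mat m n" and 0: "R + T * K = 0\<^sub>m m n"
  shows "det (four_block_mat P Q R T) = det (P + Q * K) * det T"
proof -
  let ?E = "four_block_mat (1\<^sub>m n) (0\<^sub>m n m) K (1\<^sub>m m)"
  have "four_block_mat P Q R T * ?E = four_block_mat (P + Q * K) Q (0\<^sub>m m n) T"
    by (subst mult_four_block_mat[OF P Q R T, of _ n _ m]) (use P Q R T K 0 in auto)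
  then have "det (four_block_mat P Q R T) * det ?E = det (P + Q * K) * det T"
    using det_mult[of "four_block_mat P Q R T" "n + m" ?E]
      det_four_block_mat_lower_left_zero[of "P + Q * K" n Q m "0\<^sub>m m n" T] P Q R T K by simp
  moreover have "det ?E = 1"
    using det_four_block_mat_upper_right_zero[of "1\<^sub>m n" n "0\<^sub>m n m" m K "1\<^sub>m m"] K by simp
  ultimately show ?thesis by simp
qed

lemma det_four_block_eliminate_upper:
  fixes P :: "'k :: idom mat"
  assumes P: "P \<in> carrier_mat n n" and Q: "Q \<in> carrier_mat n m"
    and R: "R \<in> carrier_mat m n" and T: "T \<in> carrier_mat m m"
    and K: "K \<in> carrier_mat n m" and 0: "P * K + Q = 0\<^sub>m n m"
  shows "det (four_block_mat P Q R T) = det P * det (R * K + T)"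
proof -
  let ?E = "four_block_mat (1\<^sub>m n) K (0\<^sub>m m n) (1\<^sub>m m)"
  have "four_block_mat P Q R T * ?E = four_block_mat P (0\<^sub>m n m) R (R * K + T)"
    by (subst mult_four_block_mat[OF P Q R T, of _ n _ m]) (use P Q R T K 0 in auto)
  then have "det (four_block_mat P Q R T) * det ?E = det P * det (R * K + T)"
    using det_mult[of "four_block_mat P Q R T" "n + m" ?E]
      det_four_block_mat_upper_right_zero[of P n "0\<^sub>m n m" m R "R * K + T"] P Q R T K by simp
  moreover have "det ?E = 1"
    using det_four_block_mat_lower_left_zero[of "1\<^sub>m n" n K m "0\<^sub>m m n" "1\<^sub>m m"] K by simp
  ultimately show ?thesis by simp
qed

lemma det_on_eliminate_lower:
  fixes f :: "'a \<Rightarrow> 'a \<Rightarrow> 'k :: idom"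
  assumes fin: "finite S" "finite T" and disj: "S \<inter> T = {}"
    and 0: "\<And>w v. w \<in> T \<Longrightarrow> v \<in> S \<Longrightarrow> f w v + (\<Sum>z\<in>T. f w z * k z v) = 0"
  shows "det_on (S \<union> T) f = det_on S (\<lambda>u v. f u v + (\<Sum>w\<in>T. f u w * k w v)) * det_on T f"
proof -
  obtain xs where xs: "distinct xs" "set xs = S" using finite_distinct_list[OF fin(1)] by auto
  obtain ys where ys: "distinct ys" "set ys = T" using finite_distinct_list[OF fin(2)] by auto
  have "list_mat f ys xs + list_mat f ys ys * list_mat k ys xs =
      list_mat (\<lambda>w v. f w v + (\<Sum>z\<in>T. f w z * k z v)) ys xs"
    using ys by (simp add: list_mat_mult list_mat_add)
  also have "\<dots> = 0\<^sub>m (length ys) (length xs)"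
    using 0 xs ys by (intro eq_matI) (auto simp: list_mat_def)
  finally have "det (list_mat f (xs @ ys) (xs @ ys)) =
      det (list_mat f xs xs + list_mat f xs ys * list_mat k ys xs) * det (list_mat f ys ys)"
    unfolding list_mat_append
    by (intro det_four_block_eliminate_lower) (rule list_mat_carrier)+
  moreover have "list_mat f xs xs + list_mat f xs ys * list_mat k ys xs =
      list_mat (\<lambda>u v. f u v + (\<Sum>w\<in>T. f u w * k w v)) xs xs"
    using ys by (simp add: list_mat_mult list_mat_add)
  moreover have "det_on (S \<union> T) f = det (list_mat f (xs @ ys) (xs @ ys))"
    using xs ys disj by (intro det_on_eq) auto
  ultimately show ?thesis using xs ys by (simp add: det_on_eq)
qed

lemma det_on_eliminate_upper:
  fixes f :: "'a \<Rightarrow> 'a \<Rightarrow> 'k :: idom"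
  assumes fin: "finite S" "finite T" and disj: "S \<inter> T = {}"
    and 0: "\<And>u w. u \<in> S \<Longrightarrow> w \<in> T \<Longrightarrow> (\<Sum>v\<in>S. f u v * k v w) + f u w = 0"
  shows "det_on (S \<union> T) f = det_on S f * det_on T (\<lambda>w z. (\<Sum>v\<in>S. f w v * k v z) + f w z)"
proof -
  obtain xs where xs: "distinct xs" "set xs = S" using finite_distinct_list[OF fin(1)] by auto
  obtain ys where ys: "distinct ys" "set ys = T" using finite_distinct_list[OF fin(2)] by auto
  have "list_mat f xs xs * list_mat k xs ys + list_mat f xs ys =
      list_mat (\<lambda>u w. (\<Sum>v\<in>S. f u v * k v w) + f u w) xs ys"
    using xs by (simp add: list_mat_mult list_mat_add)
  also have "\<dots> = 0\<^sub>m (length xs) (length ys)"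
    using 0 xs ys by (intro eq_matI) (auto simp: list_mat_def)
  finally have "det (list_mat f (xs @ ys) (xs @ ys)) =
      det (list_mat f xs xs) * det (list_mat f ys xs * list_mat k xs ys + list_mat f ys ys)"
    unfolding list_mat_append
    by (intro det_four_block_eliminate_upper) (rule list_mat_carrier)+
  moreover have "list_mat f ys xs * list_mat k xs ys + list_mat f ys ys =
      list_mat (\<lambda>w z. (\<Sum>v\<in>S. f w v * k v z) + f w z) ys ys"
    using xs by (simp add: list_mat_mult list_mat_add)
  moreover have "det_on (S \<union> T) f = det (list_mat f (xs @ ys) (xs @ ys))"
    using xs ys disj by (intro det_on_eq) auto
  ultimately show ?thesis using xs ys by (simp add: det_on_eq)
qed

text \<open>
  The matrix determinant lemma for a multiple of the all-ones matrix. The vector \<open>y\<close> solves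
  \<open>f y = 1\<close>, so its coordinate sum is \<open>1\<^sup>T f\<^bsup>-1\<^esup> 1\<close> when \<open>f\<close> is invertible, the
  shape of a coronal. The proof borders \<open>f\<close> with one extra row and column, indexed by \<^const>\<open>None\<close>, and evaluates the bordered
  determinant by eliminating in either direction.
\<close>

lemma det_on_minus_constant:
  fixes f :: "'a \<Rightarrow> 'a \<Rightarrow> 'k :: idom"
  assumes fin: "finite S" and y: "\<And>u. u \<in> S \<Longrightarrow> (\<Sum>v\<in>S. f u v * y v) = 1"
  shows "det_on S (\<lambda>u v. f u v - k) = det_on S f * (1 - k * (\<Sum>v\<in>S. y v))"
proof -
  define g where "g p q = (case p of
      None \<Rightarrow> (case q of None \<Rightarrow> 1 | Some v \<Rightarrow> k)
    | Some u \<Rightarrow> (case q of None \<Rightarrow> 1 | Some v \<Rightarrow> f u v))" for p q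
  have "det_on (Some ` S \<union> {None}) g =
      det_on (Some ` S) (\<lambda>p q. g p q + (\<Sum>z\<in>{None}. g p z * - k)) * det_on {None} g"
    by (rule det_on_eliminate_lower) (use fin in \<open>auto simp: g_def\<close>)
  then have 1: "det_on (Some ` S \<union> {None}) g = det_on S (\<lambda>u v. f u v - k)"
    by (simp add: det_on_image fin g_def det_on_singleton)
  have sum: "(\<Sum>q\<in>Some ` S. h q) = (\<Sum>v\<in>S. h (Some v))" for h :: "'a option \<Rightarrow> 'k"
    by (simp add: sum.reindex)
  have "det_on (Some ` S \<union> {None}) g = det_on (Some ` S) g *
      det_on {None} (\<lambda>p q. (\<Sum>z\<in>Some ` S. g p z * - y (the z)) + g p q)"
    by (rule det_on_eliminate_upper)
      (use fin y in \<open>auto simp: g_def sum sum_negf\<close>)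
  also have "\<dots> = det_on S f * (1 - k * (\<Sum>v\<in>S. y v))"
    by (simp add: det_on_image fin g_def det_on_singleton sum sum_negf sum_distrib_left)
  finally show ?thesis using 1 by simp
qed

section \<open>Degrees and arcs of the subdivision-arc join\<close>

lemma out_degree_eq_card_successors:
  "out_degree (with_proj D) v = card {w. (v, w) \<in> parcs D}"
proof -
  have "out_arcs (with_proj D) v = Pair v ` {w. (v, w) \<in> parcs D}"
    by (auto simp: out_arcs_def)
  then show ?thesis by (simp add: out_degree_def card_image inj_on_def)
qed

lemma card_arcs_from: "card {e \<in> parcs D. fst e = v} = out_degree (with_proj D) v"
proof -
  have "{e \<in> parcs D. fst e = v} = Pair v ` {w. (v, w) \<in> parcs D}" by force
  then show ?thesis by (simp add: out_degree_eq_card_successors card_image inj_on_def)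
qed

lemma sum_out_degrees:
  assumes "simple_digraph D"
  shows "(\<Sum>v\<in>pverts D. out_degree (with_proj D) v) = card (parcs D)"
proof -
  interpret pair_digraph D using assms by (simp add: simple_digraph_def)
  have "(\<Sum>v\<in>pverts D. card {e \<in> parcs D. fst e = v}) = card (parcs D)"
    using sum.group[of "parcs D" "pverts D" fst "\<lambda>_. 1 :: nat"] pair_finite_arcs pair_finite_verts
      in_arcsD1 by (simp add: image_subset_iff)
  then show ?thesis by (simp add: card_arcs_from)
qed

lemma card_arcs_out_regular:
  assumes "simple_digraph D" "out_regular r D"
  shows "card (parcs D) = card (pverts D) * r"
  using sum_out_degrees[OF assms(1)] assms(2) by (simp add: out_regular_def)

lemma join_vertex_cases:
  obtains (old) u where "z = Inl (Inl u)" | (new) e where "z = Inl (Inr e)" | (second) w where "z = Inr w"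
  by (metis sum.exhaust)

lemma arcs_join [simp]:
  "(Inl (Inl u), Inl (Inl v)) \<notin> parcs (subdivision_arc_join D1 D2)"
  "(Inl (Inl u), Inl (Inr e)) \<in> parcs (subdivision_arc_join D1 D2) \<longleftrightarrow> e \<in> parcs D1 \<and> fst e = u"
  "(Inl (Inr e), Inl (Inl v)) \<in> parcs (subdivision_arc_join D1 D2) \<longleftrightarrow> e \<in> parcs D1 \<and> snd e = v"
  "(Inl (Inr e), Inl (Inr e')) \<notin> parcs (subdivision_arc_join D1 D2)"
  "(Inl (Inl u), Inr w) \<notin> parcs (subdivision_arc_join D1 D2)"
  "(Inr w, Inl (Inl u)) \<notin> parcs (subdivision_arc_join D1 D2)"
  "(Inl (Inr e), Inr w) \<in> parcs (subdivision_arc_join D1 D2) \<longleftrightarrow> e \<in> parcs D1 \<and> w \<in> pverts D2"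
  "(Inr w, Inl (Inr e)) \<in> parcs (subdivision_arc_join D1 D2) \<longleftrightarrow> e \<in> parcs D1 \<and> w \<in> pverts D2"
  "(Inr w, Inr z) \<in> parcs (subdivision_arc_join D1 D2) \<longleftrightarrow> (w, z) \<in> parcs D2"
  by (cases e; force simp: subdivision_arc_join_def subdivision_digraph_def new_vertices_def)+

lemma out_degree_join_old:
  "out_degree (with_proj (subdivision_arc_join D1 D2)) (Inl (Inl u)) = out_degree (with_proj D1) u"
proof -
  have "{z. (Inl (Inl u), z) \<in> parcs (subdivision_arc_join D1 D2)} =
      (Inl \<circ> Inr) ` {e \<in> parcs D1. fst e = u}" (is "?L = ?R")
  proof (rule Set.set_eqI)
    fix z show "z \<in> ?L \<longleftrightarrow> z \<in> ?R" by (cases z rule: join_vertex_cases) auto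
  qed
  then show ?thesis
    by (simp add: out_degree_eq_card_successors[of "subdivision_arc_join D1 D2"] card_image inj_on_def
        card_arcs_from)
qed

lemma out_degree_join_new:
  assumes "finite (pverts D2)" "e \<in> parcs D1"
  shows "out_degree (with_proj (subdivision_arc_join D1 D2)) (Inl (Inr e)) = card (pverts D2) + 1"
proof -
  have set: "{z. (Inl (Inr e), z) \<in> parcs (subdivision_arc_join D1 D2)} =
      insert (Inl (Inl (snd e))) (Inr ` pverts D2)" (is "?L = ?R")
  proof (rule Set.set_eqI)
    fix z show "z \<in> ?L \<longleftrightarrow> z \<in> ?R" using assms(2) by (cases z rule: join_vertex_cases) auto
  qed
  show ?thesis
    unfolding out_degree_eq_card_successors set using assms(1)
    by (subst card_insert_disjoint) (auto simp: card_image)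
qed

lemma out_degree_join_second:
  assumes "pair_digraph D2" "finite (parcs D1)" "w \<in> pverts D2"
  shows "out_degree (with_proj (subdivision_arc_join D1 D2)) (Inr w) =
    out_degree (with_proj D2) w + card (parcs D1)"
proof -
  interpret pair_digraph D2 by fact
  have set: "{z. (Inr w, z) \<in> parcs (subdivision_arc_join D1 D2)} =
      Inr ` {z. (w, z) \<in> parcs D2} \<union> (Inl \<circ> Inr) ` parcs D1" (is "?L = ?R")
  proof (rule Set.set_eqI)
    fix z show "z \<in> ?L \<longleftrightarrow> z \<in> ?R" using assms(3) by (cases z rule: join_vertex_cases) auto
  qed
  have "finite {z. (w, z) \<in> parcs D2}"
    by (rule finite_subset[OF _ pair_finite_verts]) (use in_arcsD2 in auto)
  then show ?thesis
    unfolding out_degree_eq_card_successors set using assms(2)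
    by (subst card_Un_disjoint) (auto simp: card_image inj_on_def)
qed

section \<open>The characteristic determinant of the join\<close>

text \<open>
  The entries of \<open>x I - (D\<^sub>o\<^sub>u\<^sub>t + s A)\<close>: the sign \<open>s = -1\<close> belongs to the Laplacian matrix and
  \<open>s = 1\<close> to the signless one. The point \<open>x\<close> is an element of any field, so that the same
  expression serves for the indeterminate and for the values substituted for it.
\<close>

definition char_entry ::
    "'k :: field \<Rightarrow> 'a pair_pre_digraph \<Rightarrow> 'k \<Rightarrow> 'a \<Rightarrow> 'a \<Rightarrow> 'k" where
  "char_entry s D x u v =
     (if u = v then x - of_nat (out_degree (with_proj D) u) else 0)
     - (if (u, v) \<in> parcs D then s else 0)"

text \<open>
  The entries of \<open>t I - A\<close>. For an out-regular digraph both Laplacian matrices are affine functions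
  of \<open>A\<close>, so this is what their characteristic matrices reduce to.
\<close>

abbreviation "adj_char D t \<equiv> \<lambda>u v. (if u = v then t else 0) - (if (u, v) \<in> parcs D then 1 else 0)"

text \<open>
  Write \<open>F\<close> for the incidence matrix of arcs and their tails, \<open>H\<close> for that of arcs and their heads,
  and \<open>J\<close> for an all-ones block. Then \<open>F H = A(D\<^sub>1)\<close>, and out-regularity says \<open>F J = r J\<close>. With the
  vertices grouped as old vertices, vertices of \<open>D\<^sub>2\<close>, new vertices, the matrix is
  \<open>((a I, 0, -s F), (0, c I - M\<^sub>2, -s J), (-s H, -s J, b I))\<close>
  where \<open>c = x - n\<^sub>1 r\<close> and \<open>M\<^sub>2\<close> is the matrix \<open>D\<^sub>o\<^sub>u\<^sub>t + s A\<close> of \<open>D\<^sub>2\<close>. As \<open>s\<^sup>2 = 1\<close>, eliminating the new vertices turns the remaining blocks into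
  \<open>(a b I - A(D\<^sub>1)) / b\<close>, \<open>- (r / b) J\<close>, \<open>- J H / b\<close> and \<open>c I - M\<^sub>2 - (n\<^sub>1 r / b) J\<close>. All rows of
  \<open>a b I - A(D\<^sub>1)\<close> have the sum \<open>a b - r\<close>, so a constant multiplier clears the upper right block. The
  entries of \<open>H\<close>, one in each row, contribute \<open>n\<^sub>1 r\<close> in total; hence the in-degrees drop out and the
  block of \<open>D\<^sub>2\<close> becomes \<open>c I - M\<^sub>2\<close> minus a multiple of the all-ones matrix.
\<close>

lemma det_join:
  fixes D1 :: "'a pair_pre_digraph" and D2 :: "'b pair_pre_digraph" and s x :: "'k :: field"
  assumes D1: "simple_digraph D1" and D2: "simple_digraph D2" and reg: "out_regular r D1"
    and s: "s * s = 1"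
  defines "n1 \<equiv> card (pverts D1)" and "n2 \<equiv> card (pverts D2)"
  defines "a \<equiv> x - of_nat r" and "b \<equiv> x - 1 - of_nat n2"
  assumes b: "b \<noteq> 0" and ab: "a * b - of_nat r \<noteq> 0"
    and y: "\<And>u. u \<in> pverts D2 \<Longrightarrow>
      (\<Sum>v\<in>pverts D2. char_entry s D2 (x - of_nat (n1 * r)) u v * y v) = 1"
  shows "det_on (pverts (subdivision_arc_join D1 D2)) (char_entry s (subdivision_arc_join D1 D2) x) =
    b powi (int n1 * (int r - 1))
    * det_on (pverts D2) (char_entry s D2 (x - of_nat (n1 * r)))
    * det_on (pverts D1) (adj_char D1 (a * b))
    * (1 - of_nat (n1 * r) * a / (a * b - of_nat r) * (\<Sum>v\<in>pverts D2. y v))"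
proof -
  interpret D1: pair_digraph D1 using D1 by (simp add: simple_digraph_def)
  interpret D2: pair_digraph D2 using D2 by (simp add: simple_digraph_def)
  define J where "J = subdivision_arc_join D1 D2"
  define f where "f = char_entry s J x"
  let ?p = "Inl \<circ> Inl :: 'a \<Rightarrow> ('a + 'a \<times> 'a) + 'b"
  let ?t = "Inl \<circ> Inr :: 'a \<times> 'a \<Rightarrow> ('a + 'a \<times> 'a) + 'b"
  let ?q = "Inr :: 'b \<Rightarrow> ('a + 'a \<times> 'a) + 'b"
  define V1 where "V1 = ?p ` pverts D1"
  define N where "N = ?t ` parcs D1"
  define V2 where "V2 = ?q ` pverts D2"
  define m where "m = card (parcs D1)"
  have m: "m = n1 * r"
    using card_arcs_out_regular[OF D1 reg] by (simp add: m_def n1_def)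
  have verts: "pverts J = (V1 \<union> V2) \<union> N"
    by (auto simp: J_def V1_def V2_def N_def subdivision_arc_join_def subdivision_digraph_def
        new_vertices_def)
  have fin: "finite V1" "finite V2" "finite N" "finite (pverts D1)" "finite (pverts D2)"
      "finite (parcs D1)"
    by (auto simp: V1_def V2_def N_def)
  have sumV1: "(\<Sum>z\<in>V1. h z) = (\<Sum>u\<in>pverts D1. h (Inl (Inl u)))"
    and sumN: "(\<Sum>z\<in>N. h z) = (\<Sum>e\<in>parcs D1. h (Inl (Inr e)))"
    for h :: "('a + 'a \<times> 'a) + 'b \<Rightarrow> 'k"
    by (simp_all add: V1_def N_def V2_def sum.reindex inj_on_def)
  have f11: "f (Inl (Inl u)) (Inl (Inl v)) = (if u = v then a else 0)" if "u \<in> pverts D1" for u v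
    using that reg by (auto simp: f_def J_def char_entry_def out_degree_join_old out_regular_def a_def)
  have f1n: "f (Inl (Inl u)) (Inl (Inr e)) = - (if fst e = u then s else 0)"
    and fn1: "f (Inl (Inr e)) (Inl (Inl u)) = - (if snd e = u then s else 0)"
    if "e \<in> parcs D1" for u e
    using that by (simp_all add: f_def J_def char_entry_def)
  have f12: "f (Inl (Inl u)) (Inr w) = 0" "f (Inr w) (Inl (Inl u)) = 0" for u w
    by (simp_all add: f_def J_def char_entry_def)
  have fnn: "f (Inl (Inr e)) (Inl (Inr e')) = (if e = e' then b else 0)"
    if "e \<in> parcs D1" for e e'
    using that by (auto simp: f_def J_def char_entry_def out_degree_join_new fin b_def n2_def)
  have fn2: "f (Inl (Inr e)) (Inr w) = - s" "f (Inr w) (Inl (Inr e)) = - s"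
    if "e \<in> parcs D1" "w \<in> pverts D2" for e w
    using that by (simp_all add: f_def J_def char_entry_def)
  have f22: "f (Inr w) (Inr z) = char_entry s D2 (x - of_nat m) w z" if "w \<in> pverts D2" for w z
    using that
    by (auto simp: f_def J_def char_entry_def out_degree_join_second D2.pair_digraph_axioms fin m_def)

  \<comment> \<open>The block of the new vertices is \<open>b I\<close>, so dividing by \<open>b\<close> inverts it.\<close>
  define g where "g u v = f u v + (\<Sum>w\<in>N. f u w * (- f w v / b))" for u v
  have "det_on (pverts J) f = det_on (V1 \<union> V2) g * det_on N f"
    unfolding verts g_def
  proof (rule det_on_eliminate_lower)
    fix w v assume "w \<in> N"
    then obtain e where e: "e \<in> parcs D1" "w = Inl (Inr e)" by (auto simp: N_def)
    have "(\<Sum>z\<in>N. f w z * (- f z v / b)) =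
        (\<Sum>e'\<in>parcs D1. if e = e' then - f (Inl (Inr e')) v else 0)"
      unfolding sumN by (rule sum.cong) (use e b in \<open>auto simp: fnn\<close>)
    with e fin show "f w v + (\<Sum>z\<in>N. f w z * (- f z v / b)) = 0" by (simp add: sum.delta)
  qed (use fin in \<open>auto simp: V1_def V2_def N_def\<close>)
  moreover have "det_on N f = b ^ m"
  proof -
    have "det_on N f = det_on (parcs D1) (\<lambda>e e'. f (Inl (Inr e)) (Inl (Inr e')))"
      unfolding N_def using fin by (subst det_on_image) (auto simp: inj_on_def)
    also have "\<dots> = det_on (parcs D1) (\<lambda>e e'. if e = e' then b else 0)"
      using fin by (intro det_on_cong) (auto simp: fnn)
    finally show ?thesis using fin by (simp add: det_on_diagonal m_def)
  qed
  ultimately have step1: "det_on (pverts J) f = det_on (V1 \<union> V2) g * b ^ m" by simp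

  have g11: "g (Inl (Inl u)) (Inl (Inl v)) = (1 / b) * adj_char D1 (a * b) u v"
    if "u \<in> pverts D1" for u v
  proof -
    have "(\<Sum>w\<in>N. f (Inl (Inl u)) w * (- f w (Inl (Inl v)) / b)) =
        (\<Sum>e\<in>parcs D1. if e = (u, v) then - (1 / b) else 0)"
      unfolding sumN by (rule sum.cong) (use s in \<open>auto simp: f1n fn1\<close>)
    with fin b that show ?thesis by (simp add: g_def f11 sum.delta field_simps)
  qed
  have g12: "g (Inl (Inl u)) (Inr w) = - of_nat r / b" if "u \<in> pverts D1" "w \<in> pverts D2" for u w
  proof -
    have "(\<Sum>z\<in>N. f (Inl (Inl u)) z * (- f z (Inr w) / b)) =
        (\<Sum>e\<in>parcs D1. if fst e = u then - (1 / b) else 0)"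
      unfolding sumN by (rule sum.cong) (use s that in \<open>auto simp: f1n fn2\<close>)
    also have "\<dots> = (\<Sum>e\<in>{e \<in> parcs D1. fst e = u}. - (1 / b))"
      by (rule sum.inter_filter[symmetric]) (rule fin)
    also have "\<dots> = - of_nat r / b"
      using reg that by (simp add: card_arcs_from out_regular_def)
    finally show ?thesis by (simp add: g_def f12)
  qed
  have g21: "g (Inr w) (Inl (Inl u)) = (\<Sum>e\<in>parcs D1. if snd e = u then - (1 / b) else 0)"
    if "w \<in> pverts D2" for u w
  proof -
    have "(\<Sum>z\<in>N. f (Inr w) z * (- f z (Inl (Inl u)) / b)) =
        (\<Sum>e\<in>parcs D1. if snd e = u then - (1 / b) else 0)"
      unfolding sumN by (rule sum.cong) (use s that in \<open>auto simp: fn1 fn2\<close>)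
    then show ?thesis by (simp add: g_def f12)
  qed
  have g22: "g (Inr w) (Inr z) = char_entry s D2 (x - of_nat m) w z - of_nat m / b"
    if "w \<in> pverts D2" "z \<in> pverts D2" for w z
  proof -
    have "(\<Sum>k\<in>N. f (Inr w) k * (- f k (Inr z) / b)) = (\<Sum>e\<in>parcs D1. - (1 / b))"
      unfolding sumN by (rule sum.cong) (use s that in \<open>auto simp: fn2\<close>)
    then show ?thesis using that by (simp add: g_def f22 m_def)
  qed

  \<comment> \<open>The constant multiplier for the second elimination: the row sums \<open>(a b - r) / b\<close> of the
     block of the old vertices times \<open>\<kappa>\<close> compensate the entries \<open>- r / b\<close>.\<close>
  define \<kappa> where "\<kappa> = of_nat r / (a * b - of_nat r)"
  have row: "(\<Sum>v\<in>pverts D1. adj_char D1 (a * b) u v) = a * b - of_nat r" if u: "u \<in> pverts D1" for u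
  proof -
    have "(\<Sum>v\<in>pverts D1. if (u, v) \<in> parcs D1 then 1 else 0 :: 'k) =
        (\<Sum>v\<in>{v \<in> pverts D1. (u, v) \<in> parcs D1}. 1)"
      by (rule sum.inter_filter[symmetric]) (rule fin)
    also have "{v \<in> pverts D1. (u, v) \<in> parcs D1} = {v. (u, v) \<in> parcs D1}"
      using D1.in_arcsD2 by auto
    finally have "(\<Sum>v\<in>pverts D1. if (u, v) \<in> parcs D1 then 1 else 0 :: 'k) = of_nat r"
      using reg u by (simp add: out_regular_def out_degree_eq_card_successors)
    with fin u show ?thesis by (simp add: sum_subtractf sum.delta)
  qed
  have column: "(\<Sum>u\<in>pverts D1. \<Sum>e\<in>parcs D1. if snd e = u then - (1 / b) else 0) = - of_nat m / b"
  proof -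
    have "(\<Sum>u\<in>pverts D1. \<Sum>e\<in>parcs D1. if snd e = u then - (1 / b) else 0) =
        (\<Sum>e\<in>parcs D1. \<Sum>u\<in>pverts D1. if snd e = u then - (1 / b) else 0)"
      by (rule sum.swap)
    also have "\<dots> = (\<Sum>e\<in>parcs D1. - (1 / b))"
      by (rule sum.cong) (use fin D1.in_arcsD2 in \<open>auto simp: sum.delta\<close>)
    finally show ?thesis by (simp add: m_def)
  qed
  \<comment> \<open>Both eliminations subtract a constant from the block of \<open>D\<^sub>2\<close>; \<open>\<delta>\<close> is the sum
     \<open>m / b + (m / b) \<kappa>\<close> of the two.\<close>
  define \<delta> where "\<delta> = of_nat m * a / (a * b - of_nat r)"
  have "det_on (V1 \<union> V2) g = det_on V1 g * det_on V2 (\<lambda>w z. (\<Sum>v\<in>V1. g w v * \<kappa>) + g w z)"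
  proof (rule det_on_eliminate_upper)
    fix u w assume "u \<in> V1" "w \<in> V2"
    then obtain u' w' where u: "u' \<in> pverts D1" "u = Inl (Inl u')" and w: "w' \<in> pverts D2" "w = Inr w'"
      by (auto simp: V1_def V2_def)
    have "(\<Sum>v\<in>V1. g u v) = (1 / b) * (a * b - of_nat r)"
      unfolding row[OF u(1), symmetric] sum_distrib_left sumV1 by (rule sum.cong) (use u g11 in auto)
    then have "(\<Sum>v\<in>V1. g u v * \<kappa>) = of_nat r / b"
      unfolding sum_distrib_right[symmetric] using ab by (simp add: \<kappa>_def)
    with u w show "(\<Sum>v\<in>V1. g u v * \<kappa>) + g u w = 0" by (simp add: g12)
  qed (use fin in \<open>auto simp: V1_def V2_def\<close>)
  also have "det_on V1 g = (1 / b) ^ n1 * det_on (pverts D1) (adj_char D1 (a * b))"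
  proof -
    have "det_on V1 g = det_on (pverts D1) (\<lambda>u v. g (Inl (Inl u)) (Inl (Inl v)))"
      unfolding V1_def using fin by (subst det_on_image) (auto simp: inj_on_def)
    also have "\<dots> = det_on (pverts D1) (\<lambda>u v. (1 / b) * adj_char D1 (a * b) u v)"
      by (rule det_on_cong[OF fin(4) g11])
    finally show ?thesis using fin by (simp only: det_on_scale n1_def)
  qed
  also have "det_on V2 (\<lambda>w z. (\<Sum>v\<in>V1. g w v * \<kappa>) + g w z) =
      det_on (pverts D2) (char_entry s D2 (x - of_nat m)) * (1 - \<delta> * (\<Sum>v\<in>pverts D2. y v))"
  proof -
    have "det_on V2 (\<lambda>w z. (\<Sum>v\<in>V1. g w v * \<kappa>) + g w z) =
        det_on (pverts D2) (\<lambda>w z. (\<Sum>v\<in>V1. g (Inr w) v * \<kappa>) + g (Inr w) (Inr z))"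
      unfolding V2_def using fin by (subst det_on_image) (auto simp: inj_on_def)
    also have "\<dots> = det_on (pverts D2) (\<lambda>w z. char_entry s D2 (x - of_nat m) w z - \<delta>)"
    proof (rule det_on_cong[OF fin(5)])
      fix w z assume wz: "w \<in> pverts D2" "z \<in> pverts D2"
      have "(\<Sum>v\<in>V1. g (Inr w) v * \<kappa>) = - of_nat m / b * \<kappa>"
        unfolding column[symmetric] sum_distrib_right[symmetric] sumV1 using wz by (simp only: g21)
      moreover have "of_nat m / b * \<kappa> + of_nat m / b = \<delta>"
        using b ab by (simp add: \<kappa>_def \<delta>_def field_simps)
      ultimately show "(\<Sum>v\<in>V1. g (Inr w) v * \<kappa>) + g (Inr w) (Inr z) =
          char_entry s D2 (x - of_nat m) w z - \<delta>"
        using wz by (simp add: g22 algebra_simps)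
    qed
    also have "\<dots> = det_on (pverts D2) (char_entry s D2 (x - of_nat m)) * (1 - \<delta> * (\<Sum>v\<in>pverts D2. y v))"
      by (rule det_on_minus_constant) (use fin y m in auto)
    finally show ?thesis .
  qed
  finally have step2: "det_on (V1 \<union> V2) g = (1 / b) ^ n1 * det_on (pverts D1) (adj_char D1 (a * b))
      * (det_on (pverts D2) (char_entry s D2 (x - of_nat m)) * (1 - \<delta> * (\<Sum>v\<in>pverts D2. y v)))" .
  \<comment> \<open>The exponent is negative when \<open>r = 0\<close>, which is why it is an integer power.\<close>
  have "int n1 * (int r - 1) = int m - int n1" by (simp add: m algebra_simps)
  then have "b powi (int n1 * (int r - 1)) = (1 / b) ^ n1 * b ^ m"
    using b by (simp add: power_int_diff power_one_over field_simps)
  with step1 step2 show ?thesis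
    unfolding J_def[symmetric] f_def[symmetric] m[symmetric] \<delta>_def[symmetric]
    by (simp add: ac_simps)
qed

section \<open>Substitution into polynomials and rational functions\<close>

lemma comm_ring_hom_to_fract_const: "comm_ring_hom (\<lambda>c :: complex. to_fract [:c:])"
proof
  fix a b :: complex
  show "to_fract [:a + b:] = to_fract [:a:] + to_fract [:b:]"
    by (simp add: to_fract_add[symmetric] del: to_fract_add)
  show "to_fract [:a * b:] = to_fract [:a:] * to_fract [:b:]"
    by (simp add: to_fract_mult[symmetric] del: to_fract_mult)
  show "to_fract [:1 :: complex:] = 1" by (simp add: one_pCons[symmetric])
qed simp

interpretation const_hom: comm_ring_hom "\<lambda>c :: complex. to_fract [:c:]"
  by (rule comm_ring_hom_to_fract_const)

interpretation const_poly_hom: map_poly_comm_ring_hom "\<lambda>c :: complex. to_fract [:c:]" ..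

interpretation subst_poly_hom: comm_ring_hom "\<lambda>p. subst_poly p x" for x
  by unfold_locales (simp_all add: subst_poly_def const_poly_hom.hom_add const_poly_hom.hom_mult)

lemma to_fract_of_nat: "to_fract [:of_nat n :: complex:] = of_nat n"
  by (induction n) (simp_all add: const_hom.hom_add)

lemma to_fract_of_int: "to_fract [:of_int k :: complex:] = of_int k"
  by (cases k rule: int_cases2) (simp_all add: to_fract_of_nat const_hom.hom_uminus)

lemma subst_poly_const [simp]: "subst_poly [:c:] x = to_fract [:c:]"
  by (cases "c = 0") (simp_all add: subst_poly_def map_poly_pCons)

lemma subst_poly_indeterminate [simp]: "subst_poly [:0, 1:] x = x"
  by (simp add: subst_poly_def map_poly_pCons)

lemma subst_poly_to_fract: "subst_poly p (to_fract q) = to_fract (pcompose p q)"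
proof (induction p)
  case (pCons a p)
  have "subst_poly (pCons a p) (to_fract q) = subst_poly ([:a:] + [:0, 1:] * p) (to_fract q)"
    by simp
  also have "\<dots> = to_fract ([:a:] + q * pcompose p q)"
    unfolding subst_poly_hom.hom_add subst_poly_hom.hom_mult pCons.IH by simp
  finally show ?case by (simp add: pcompose_pCons)
qed simp

lemma subst_poly_lam: "subst_poly p lam = to_fract p"
  by (simp add: lam_def subst_poly_to_fract pcompose_idR)

lemma lam_minus_of_nat: "lam - of_nat k = to_fract [:- of_nat k, 1:]"
proof -
  have "lam - of_nat k = to_fract ([:0, 1:] - [:of_nat k:])"
    by (simp only: to_fract_diff lam_def to_fract_of_nat)
  then show ?thesis by simp
qed

text \<open>
  The shifted indeterminate is transcendental over the constants, so no denominator vanishes under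
  the substitution.
\<close>

lemma subst_poly_shift_nonzero:
  assumes "p \<noteq> 0"
  shows "subst_poly p (lam - of_nat k) \<noteq> 0"
  using assms pcompose_eq_0[of p "[:- of_nat k, 1:]"]
  by (auto simp: lam_minus_of_nat subst_poly_to_fract)

text \<open>
  At a point where no nonzero polynomial vanishes, substitution is a field homomorphism, and it can
  be computed from any representation as a fraction instead of the normalised one.
\<close>

context
  fixes x :: "complex poly fract"
  assumes nonzero: "\<And>p. p \<noteq> 0 \<Longrightarrow> subst_poly p x \<noteq> 0"
begin

lemma subst_ratfun_divide:
  assumes b: "b \<noteq> 0"
  shows "subst_ratfun (to_fract a / to_fract b) x = subst_poly a x / subst_poly b x"
proof -
  obtain c d where q: "quot_of_fract (to_fract a / to_fract b) = (c, d)" by force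
  then have d: "d \<noteq> 0" using snd_quot_of_fract_nonzero[of "to_fract a / to_fract b"] by simp
  have "to_fract a / to_fract b = to_fract c / to_fract d"
    using Fract_quot_of_fract[of "to_fract a / to_fract b"] q by (simp add: Fract_conv_to_fract)
  then have "to_fract (a * d) = to_fract (c * b)" using b d by (simp add: field_simps)
  then have "subst_poly (a * d) x = subst_poly (c * b) x" by (simp only: to_fract_eq_iff)
  then show ?thesis
    using q b d nonzero[of b] nonzero[of d]
    by (simp add: subst_ratfun_def subst_poly_hom.hom_mult field_simps)
qed

lemma subst_ratfun_to_fract: "subst_ratfun (to_fract a) x = subst_poly a x"
  using subst_ratfun_divide[of 1 a] by simp

lemma comm_ring_hom_subst_ratfun: "comm_ring_hom (\<lambda>q. subst_ratfun q x)"
proof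
  fix p q :: "complex poly fract"
  obtain a b where p: "p = to_fract a / to_fract b" "b \<noteq> 0"
    by (metis Fract_conv_to_fract Fract_quot_of_fract snd_quot_of_fract_nonzero)
  obtain c d where q: "q = to_fract c / to_fract d" "d \<noteq> 0"
    by (metis Fract_conv_to_fract Fract_quot_of_fract snd_quot_of_fract_nonzero)
  have eval: "subst_ratfun p x = subst_poly a x / subst_poly b x"
      "subst_ratfun q x = subst_poly c x / subst_poly d x"
    unfolding p(1) q(1) using p(2) q(2) by (auto intro: subst_ratfun_divide)
  have nz: "subst_poly b x \<noteq> 0" "subst_poly d x \<noteq> 0" using p q nonzero by auto
  have "p + q = to_fract (a * d + c * b) / to_fract (b * d)" using p q by (simp add: field_simps)
  then have "subst_ratfun (p + q) x = subst_poly (a * d + c * b) x / subst_poly (b * d) x"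
    using p q by (simp only: subst_ratfun_divide mult_eq_0_iff simp_thms)
  then show "subst_ratfun (p + q) x = subst_ratfun p x + subst_ratfun q x"
    using nz by (simp add: eval subst_poly_hom.hom_mult subst_poly_hom.hom_add add_frac_eq)
  have "p * q = to_fract (a * c) / to_fract (b * d)" using p q by (simp add: field_simps)
  then have "subst_ratfun (p * q) x = subst_poly (a * c) x / subst_poly (b * d) x"
    using p q by (simp only: subst_ratfun_divide mult_eq_0_iff simp_thms)
  then show "subst_ratfun (p * q) x = subst_ratfun p x * subst_ratfun q x"
    by (simp add: eval subst_poly_hom.hom_mult)
next
  show "subst_ratfun 1 x = 1" using subst_ratfun_to_fract[of 1] by simp
  show "subst_ratfun 0 x = 0" using subst_ratfun_to_fract[of 0] by simp
qed

end

section \<open>Characteristic polynomials and coronals of digraph matrices\<close>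

definition signed_matrix :: "int \<Rightarrow> 'a list \<Rightarrow> 'a pair_pre_digraph \<Rightarrow> real mat" where
  "signed_matrix s vs D = out_degree_matrix vs D + of_int s \<cdot>\<^sub>m adjacency_matrix vs D"

lemma laplacian_eq_signed: "laplacian_matrix vs D = signed_matrix (- 1) vs D"
  by (auto simp: laplacian_matrix_def signed_matrix_def adjacency_matrix_def out_degree_matrix_def
      mat_diag_def intro!: eq_matI)

lemma signless_laplacian_eq_signed: "signless_laplacian_matrix vs D = signed_matrix 1 vs D"
  by (auto simp: signless_laplacian_matrix_def signed_matrix_def adjacency_matrix_def
      out_degree_matrix_def mat_diag_def intro!: eq_matI)

lemma signed_matrix_carrier [simp]: "signed_matrix s vs D \<in> carrier_mat (length vs) (length vs)"
  by (simp add: signed_matrix_def adjacency_matrix_def out_degree_matrix_def)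

lemma subst_poly_char_poly_matrix_entry:
  assumes "distinct vs" "i < length vs" "j < length vs"
  shows "subst_poly (char_poly_matrix (map_mat complex_of_real (signed_matrix s vs D)) $$ (i, j)) x =
    char_entry (of_int s) D x (vs ! i) (vs ! j)"
proof -
  have "char_poly_matrix (map_mat complex_of_real (signed_matrix s vs D)) $$ (i, j) =
      (if i = j then [:0, 1:] - [:of_nat (out_degree (with_proj D) (vs ! i)):] else 0)
      - (if (vs ! i, vs ! j) \<in> parcs D then [:of_int s:] else 0)"
    using assms(2,3)
    by (simp add: char_poly_matrix_def signed_matrix_def out_degree_matrix_def
        adjacency_matrix_def mat_diag_def)
  moreover have "i = j \<longleftrightarrow> vs ! i = vs ! j" using assms by (simp add: nth_eq_iff_index_eq)
  ultimately show ?thesis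
    unfolding char_entry_def
    by (simp add: subst_poly_hom.hom_minus to_fract_of_nat to_fract_of_int del: diff_pCons)
qed

text \<open>
  Evaluation at \<open>x\<close> commutes with the determinant. This turns every characteristic polynomial in the
  formulas, with whatever argument, into a determinant over the field of rational functions.
\<close>

lemma subst_poly_charpoly:
  assumes "vertex_ordering vs D"
  shows "subst_poly (charpoly (signed_matrix s vs D)) x = det_on (pverts D) (char_entry (of_int s) D x)"
proof -
  have vs: "distinct vs" "set vs = pverts D" using assms by (auto simp: vertex_ordering_def)
  let ?R = "char_poly_matrix (map_mat complex_of_real (signed_matrix s vs D))"
  have "?R \<in> carrier_mat (length vs) (length vs)" by simp
  note R = carrier_matD[OF this]
  have "subst_poly (charpoly (signed_matrix s vs D)) x = det (map_mat (\<lambda>p. subst_poly p x) ?R)"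
    by (simp add: charpoly_def char_poly_def)
  also have "map_mat (\<lambda>p. subst_poly p x) ?R = list_mat (char_entry (of_int s) D x) vs vs"
    using vs R by (intro eq_matI) (auto simp: list_mat_def subst_poly_char_poly_matrix_entry)
  finally show ?thesis using vs by (simp add: det_on_eq)
qed

lemma charpoly_monic:
  assumes "M \<in> carrier_mat n n"
  shows "lead_coeff (charpoly M) = 1" "degree (charpoly M) = n"
  using degree_monic_char_poly[of "map_mat complex_of_real M" n] assms
  by (auto simp: charpoly_def)

text \<open>
  The coronal as the coordinate sum of a solution of a linear system with right-hand side one:
  unlike an inverse matrix, a system of equations is carried along by a ring homomorphism.
\<close>

lemma coronal_as_solution:
  assumes M: "M \<in> carrier_mat n n"
  obtains y where "\<And>i. i < n \<Longrightarrow>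
      (\<Sum>j<n. to_fract (char_poly_matrix (map_mat complex_of_real M) $$ (i, j)) * y j) = 1"
    and "coronal M = (\<Sum>j<n. y j)"
proof -
  define R where "R = map_mat to_fract (char_poly_matrix (map_mat complex_of_real M))"
  define one where "one = vec n (\<lambda>_. 1 :: complex poly fract)"
  have R: "R \<in> carrier_mat n n" using M by (simp add: R_def)
  interpret to_fract: comm_ring_hom "to_fract :: complex poly \<Rightarrow> complex poly fract"
    by unfold_locales auto
  have "det R = to_fract (charpoly M)" by (simp add: R_def charpoly_def char_poly_def)
  also have "\<dots> \<noteq> 0" using charpoly_monic(1)[OF M] by auto
  finally have "R \<in> Units (ring_mat TYPE(complex poly fract) n undefined)"
    by (rule det_non_zero_imp_unit[OF R])
  then obtain B where B: "mat_inverse R = Some B"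
    using mat_inverse(1)[OF R, of undefined] by (cases "mat_inverse R") auto
  note inv = mat_inverse(2)[OF R B]
  define y where "y = B *\<^sub>v one"
  have y: "y \<in> carrier_vec n" 
    using inv unfolding y_def one_def by (intro mult_mat_vec_carrier[of B n n]) auto
  have "R *\<^sub>v y = one" using inv R unfolding y_def
    by (subst assoc_mult_mat_vec[symmetric, of _ n n _ n]) (auto simp: one_def)
  then have "(R *\<^sub>v y) $ i = 1" if "i < n" for i using that by (simp add: one_def)
  then have sol: "(\<Sum>j<n. to_fract (char_poly_matrix (map_mat complex_of_real M) $$ (i, j)) * y $ j) = 1"
    if "i < n" for i
    using that R y M by (simp add: scalar_prod_def R_def atLeast0LessThan char_poly_matrix_def)
  have "coronal M = one \<bullet> y"
    using M B unfolding coronal_def Let_def R_def[symmetric] by (simp add: y_def one_def)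
  also have "\<dots> = (\<Sum>j<n. y $ j)" using y by (simp add: scalar_prod_def one_def atLeast0LessThan)
  finally show thesis using sol that by blast
qed

lemma subst_coronal_as_solution:
  assumes vs: "vertex_ordering vs D"
  obtains y where "\<And>u. u \<in> pverts D \<Longrightarrow>
      (\<Sum>v\<in>pverts D. char_entry (of_int s) D (lam - of_nat k) u v * y v) = 1"
    and "(\<Sum>v\<in>pverts D. y v) = subst_ratfun (coronal (signed_matrix s vs D)) (lam - of_nat k)"
proof -
  define x where "x = lam - of_nat k"
  interpret subst: comm_ring_hom "\<lambda>q. subst_ratfun q x"
    unfolding x_def by (rule comm_ring_hom_subst_ratfun) (rule subst_poly_shift_nonzero)
  have to_fract: "subst_ratfun (to_fract p) x = subst_poly p x" for p
    unfolding x_def by (rule subst_ratfun_to_fract) (rule subst_poly_shift_nonzero)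
  have d: "distinct vs" "set vs = pverts D" using vs by (auto simp: vertex_ordering_def)
  define M where "M = signed_matrix s vs D"
  obtain y where sol: "\<And>i. i < length vs \<Longrightarrow>
      (\<Sum>j<length vs. to_fract (char_poly_matrix (map_mat complex_of_real M) $$ (i, j)) * y j) = 1"
    and cor: "coronal M = (\<Sum>j<length vs. y j)"
    using coronal_as_solution[of M "length vs"] by (auto simp: M_def)
  have bij: "bij_betw ((!) vs) {..<length vs} (pverts D)" using d by (intro bij_betw_nth) auto
  define z where "z v = subst_ratfun (y (inv_into {..<length vs} ((!) vs) v)) x" for v
  have z: "z (vs ! j) = subst_ratfun (y j) x" if "j < length vs" for j
    using that bij by (simp add: z_def bij_betw_inv_into_left)
  show thesis
  proof
    fix u assume "u \<in> pverts D"
    then obtain i where i: "i < length vs" "u = vs ! i" using d by (metis in_set_conv_nth)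
    have "(\<Sum>v\<in>pverts D. char_entry (of_int s) D x u v * z v) =
        (\<Sum>j<length vs. char_entry (of_int s) D x u (vs ! j) * z (vs ! j))"
      by (rule sum.reindex_bij_betw[OF bij, symmetric])
    also have "\<dots> = (\<Sum>j<length vs.
        subst_ratfun (to_fract (char_poly_matrix (map_mat complex_of_real M) $$ (i, j)) * y j) x)"
      using i d
      by (intro sum.cong refl)
        (simp add: z subst.hom_mult to_fract M_def subst_poly_char_poly_matrix_entry)
    also have "\<dots> = subst_ratfun 1 x"
      unfolding sol[OF i(1), symmetric] by (rule subst.hom_sum[symmetric])
    finally show "(\<Sum>v\<in>pverts D. char_entry (of_int s) D (lam - of_nat k) u v * z v) = 1"
      by (simp add: x_def[symmetric])
  next
    have "(\<Sum>v\<in>pverts D. z v) = (\<Sum>j<length vs. z (vs ! j))"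
      by (rule sum.reindex_bij_betw[OF bij, symmetric])
    also have "\<dots> = (\<Sum>j<length vs. subst_ratfun (y j) x)" by (simp add: z)
    also have "\<dots> = subst_ratfun (coronal M) x" unfolding cor by (rule subst.hom_sum[symmetric])
    finally show "(\<Sum>v\<in>pverts D. z v) =
        subst_ratfun (coronal (signed_matrix s vs D)) (lam - of_nat k)"
      by (simp add: x_def M_def)
  qed
qed

section \<open>What the spectrum determines\<close>

lemma charpoly_from_spectrum:
  assumes "M \<in> carrier_mat n n"
  shows "charpoly M = (\<Prod>z\<in>#spectrum_mset M. [:- z, 1:])"
  using complex_poly_decompose_multiset[of "charpoly M"] charpoly_monic(1)[OF assms]
  by (simp add: spectrum_mset_def)

lemma prod_linear_factors_nonzero:
  fixes A :: "complex multiset"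
  shows "(\<Prod>z\<in>#A. [:- z, 1:]) \<noteq> 0"
  by (auto simp: prod_mset_zero_iff)

lemma size_spectrum:
  assumes "M \<in> carrier_mat n n"
  shows "size (spectrum_mset M) = n"
proof -
  have "degree (\<Prod>z\<in>#A. [:- z, 1:]) = size A" for A :: "complex multiset"
  proof (induction A)
    case (add z A)
    have "[:- z, 1:] \<noteq> 0" by simp
    from degree_mult_eq[OF this prod_linear_factors_nonzero[of A]] add
    show ?case by (simp del: mult_pCons_left)
  qed simp
  then show ?thesis using charpoly_from_spectrum[OF assms] charpoly_monic(2)[OF assms] by metis
qed

lemma trace_mult_comm:
  fixes P Q :: "'k :: comm_semiring_0 mat"
  assumes "P \<in> carrier_mat n n" "Q \<in> carrier_mat n n"
  shows "(\<Sum>i<n. (P * Q) $$ (i, i)) = (\<Sum>i<n. (Q * P) $$ (i, i))"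
proof -
  have "(\<Sum>i<n. (P * Q) $$ (i, i)) = (\<Sum>i<n. \<Sum>k<n. P $$ (i, k) * Q $$ (k, i))"
    using assms by (simp add: scalar_prod_def atLeast0LessThan)
  also have "\<dots> = (\<Sum>k<n. \<Sum>i<n. Q $$ (k, i) * P $$ (i, k))"
    by (subst sum.swap) (simp add: mult.commute)
  also have "\<dots> = (\<Sum>i<n. (Q * P) $$ (i, i))"
    using assms by (simp add: scalar_prod_def atLeast0LessThan)
  finally show ?thesis .
qed

text \<open>
  The sum of the eigenvalues is the trace: by the Schur decomposition the matrix is similar to a
  triangular one, whose diagonal lists the spectrum.
\<close>

lemma sum_spectrum:
  assumes M: "M \<in> carrier_mat n n"
  shows "(\<Sum>z\<in>#spectrum_mset M. z) = of_real (\<Sum>i<n. M $$ (i, i))"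
proof -
  define A where "A = map_mat complex_of_real M"
  have A: "A \<in> carrier_mat n n" using M by (simp add: A_def)
  obtain es where es: "mset es = spectrum_mset M" using ex_mset by blast
  have "char_poly A = (\<Prod>z\<leftarrow>es. [:- z, 1:])"
    using charpoly_from_spectrum[OF M] unfolding charpoly_def A_def[symmetric] es[symmetric]
    by (simp add: prod_mset_prod_list[symmetric])
  from schur_decomposition_exists[OF A this] obtain B where
    B: "B \<in> carrier_mat n n" and ut: "upper_triangular B" and sim: "similar_mat A B" by auto
  from sim obtain P Q where "similar_mat_wit A B P Q" by (auto simp: similar_mat_def)
  note PQ = similar_mat_witD2[OF A this]
  have QPB: "Q * (P * B) = B"
    using assoc_mult_mat[of Q n n P n B n] left_mult_one_mat[OF B] PQ by simp
  have "(\<Prod>z\<in>#spectrum_mset M. [:- z, 1:]) = (\<Prod>z\<in>#mset (diag_mat B). [:- z, 1:])"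
    using charpoly_from_spectrum[OF M] char_poly_similar[OF sim] char_poly_upper_triangular[OF B ut]
    by (simp add: charpoly_def A_def[symmetric] prod_mset_prod_list[symmetric])
  moreover have "proots (\<Prod>z\<in>#X. [:- z, 1:]) = X" for X :: "complex multiset"
  proof (induction X)
    case (add z X)
    have "[:- z, 1:] \<noteq> 0" by simp
    from proots_mult[OF this prod_linear_factors_nonzero[of X]] add
    show ?case by (simp del: mult_pCons_left)
  qed simp
  ultimately have "spectrum_mset M = mset (diag_mat B)" by metis
  then have "(\<Sum>z\<in>#spectrum_mset M. z) = sum_list (diag_mat B)" by (simp add: sum_mset_sum_list)
  also have "\<dots> = (\<Sum>i<n. B $$ (i, i))"
    using B by (simp add: diag_mat_def interv_sum_list_conv_sum_set_nat atLeast0LessThan)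
  also have "\<dots> = (\<Sum>i<n. (Q * (P * B)) $$ (i, i))" unfolding QPB ..
  also have "\<dots> = (\<Sum>i<n. ((P * B) * Q) $$ (i, i))"
    by (rule trace_mult_comm) (use PQ in auto)
  also have "(P * B) * Q = A" using PQ by simp
  finally show ?thesis using M by (simp add: A_def)
qed

text \<open>The adjacency matrix of a loopless digraph has zero diagonal.\<close>

lemma trace_signed_matrix:
  assumes D: "simple_digraph D" and vs: "vertex_ordering vs D"
  shows "(\<Sum>i<length vs. signed_matrix s vs D $$ (i, i)) = real (card (parcs D))"
proof -
  interpret pair_digraph D using D by (simp add: simple_digraph_def)
  have d: "distinct vs" "set vs = pverts D" using vs by (auto simp: vertex_ordering_def)
  have bij: "bij_betw ((!) vs) {..<length vs} (pverts D)" using d by (intro bij_betw_nth) auto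
  have "(\<Sum>i<length vs. signed_matrix s vs D $$ (i, i)) =
      (\<Sum>i<length vs. real (out_degree (with_proj D) (vs ! i)))"
    using pair_no_loops[of "(v, v)" for v]
    by (intro sum.cong) (auto simp: signed_matrix_def out_degree_matrix_def adjacency_matrix_def mat_diag_def)
  also have "\<dots> = (\<Sum>v\<in>pverts D. real (out_degree (with_proj D) v))"
    by (rule sum.reindex_bij_betw[OF bij])
  finally show ?thesis using sum_out_degrees[OF D] by (simp flip: of_nat_sum)
qed

lemma spectrum_determines_card:
  assumes "vertex_ordering vs D" "vertex_ordering vs' D'"
    and "spectrum_mset (signed_matrix s vs D) = spectrum_mset (signed_matrix s vs' D')"
  shows "card (pverts D) = card (pverts D')"
  using size_spectrum[OF signed_matrix_carrier[of s vs D]]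
    size_spectrum[OF signed_matrix_carrier[of s vs' D']] assms
  by (auto simp: vertex_ordering_def distinct_card dest!: distinct_card)

text \<open>
  The formulas mention the out-degree explicitly, so it has to be recovered from the spectrum: the
  trace counts the arcs, of which there are \<open>r\<close> for each vertex.
\<close>

lemma spectrum_determines_out_degree:
  assumes "simple_digraph D" "simple_digraph D'" "out_regular r D" "out_regular r' D'"
    and vs: "vertex_ordering vs D" "vertex_ordering vs' D'"
    and spec: "spectrum_mset (signed_matrix s vs D) = spectrum_mset (signed_matrix s vs' D')"
  shows "r = r'"
proof -
  interpret D: pair_digraph D using assms(1) by (simp add: simple_digraph_def)
  have "complex_of_real (real (card (parcs D))) = complex_of_real (real (card (parcs D')))"
    using sum_spectrum[OF signed_matrix_carrier[of s vs D]]
      sum_spectrum[OF signed_matrix_carrier[of s vs' D']] spec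
      trace_signed_matrix[OF assms(1) vs(1), of s] trace_signed_matrix[OF assms(2) vs(2), of s]
    by metis
  then have "card (pverts D) * r = card (pverts D) * r'"
    using card_arcs_out_regular[OF assms(1,3)] card_arcs_out_regular[OF assms(2,4)]
      spectrum_determines_card[OF vs spec] by auto
  moreover have "card (pverts D) > 0"
    using assms(1) D.pair_finite_verts by (auto simp: simple_digraph_def card_gt_0_iff)
  ultimately show ?thesis by auto
qed

section \<open>The formulas for the join\<close>

text \<open>
  The Laplacian matrix annihilates the all-ones vector. Hence its coronal at \<open>x\<close> is \<open>n / x\<close>, which
  explains why no coronal appears in the Laplacian formula.
\<close>

lemma laplacian_row_sum:
  fixes x :: "'k :: field"
  assumes D: "simple_digraph D" and u: "u \<in> pverts D"
  shows "(\<Sum>v\<in>pverts D. char_entry (- 1) D x u v) = x"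
proof -
  interpret pair_digraph D using D by (simp add: simple_digraph_def)
  have "(\<Sum>v\<in>pverts D. if (u, v) \<in> parcs D then - 1 else 0 :: 'k) =
      (\<Sum>v\<in>{v \<in> pverts D. (u, v) \<in> parcs D}. - 1)"
    by (rule sum.inter_filter[symmetric]) (rule pair_finite_verts)
  also have "{v \<in> pverts D. (u, v) \<in> parcs D} = {v. (u, v) \<in> parcs D}"
    using in_arcsD2 by auto
  finally show ?thesis
    using u by (simp add: char_entry_def sum_subtractf sum.delta' pair_finite_verts
        out_degree_eq_card_successors)
qed

lemma join_denominators_nonzero:
  shows "lam - 1 - of_nat n \<noteq> 0" "lam - of_nat k \<noteq> 0"
    "(lam - of_nat r) * (lam - 1 - of_nat n) - of_nat r \<noteq> 0"
proof -
  have k: "lam - of_nat k \<noteq> 0" for k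
    unfolding lam_minus_of_nat by (simp del: of_nat_Suc)
  have shift: "lam - 1 - of_nat n = lam - of_nat (n + 1)" by simp
  show "lam - of_nat k \<noteq> 0" by (rule k)
  show "lam - 1 - of_nat n \<noteq> 0" unfolding shift by (rule k)
  have "(lam - of_nat r) * (lam - 1 - of_nat n) - of_nat r =
      to_fract ([:- of_nat r, 1:] * [:- of_nat (n + 1), 1:] - [:of_nat r:])"
    unfolding shift lam_minus_of_nat by (simp only: to_fract_mult to_fract_diff to_fract_of_nat)
  also have "\<dots> \<noteq> 0" by (simp del: of_nat_Suc of_nat_add)
  finally show "(lam - of_nat r) * (lam - 1 - of_nat n) - of_nat r \<noteq> 0" .
qed

lemma charpoly_laplacian_join:
  assumes D: "simple_digraph D1" "simple_digraph D2" and reg: "out_regular r D1"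
    and vs: "vertex_ordering vs1 D1" "vertex_ordering vs2 D2"
      "vertex_ordering vs (subdivision_arc_join D1 D2)"
  defines "n1 \<equiv> card (pverts D1)" and "n2 \<equiv> card (pverts D2)"
  shows "to_fract (charpoly (laplacian_matrix vs (subdivision_arc_join D1 D2))) =
       (-1) ^ n1
       * (lam - 1 - of_nat n2) powi (int n1 * (int r - 1))
       * subst_poly (charpoly (laplacian_matrix vs2 D2)) (lam - of_nat n1 * of_nat r)
       * subst_poly (charpoly (laplacian_matrix vs1 D1))
           (of_nat r - (lam - of_nat r) * (lam - 1 - of_nat n2))
       * (1 - (of_nat r * (lam - of_nat r) * of_nat n1 * of_nat n2)
              / ((lam - of_nat n1 * of_nat r)
                 * ((lam - of_nat r) * (lam - 1 - of_nat n2) - of_nat r)))"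
proof -
  interpret D1: pair_digraph D1 using D by (simp add: simple_digraph_def)
  define t where "t = (lam - of_nat r) * (lam - 1 - of_nat n2)"
  define c where "c = lam - of_nat (n1 * r)"
  have c: "c \<noteq> 0" unfolding c_def by (rule join_denominators_nonzero)
  have row: "(\<Sum>v\<in>pverts D2. char_entry (- 1) D2 c u v * (1 / c)) = 1" if "u \<in> pverts D2" for u
    using c that laplacian_row_sum[OF D(2) that, of c] by (simp flip: sum_distrib_right sum_divide_distrib)
  have join: "det_on (pverts (subdivision_arc_join D1 D2))
        (char_entry (- 1) (subdivision_arc_join D1 D2) lam) =
      (lam - 1 - of_nat n2) powi (int n1 * (int r - 1))
      * det_on (pverts D2) (char_entry (- 1) D2 c) * det_on (pverts D1) (adj_char D1 t)
      * (1 - of_nat (n1 * r) * (lam - of_nat r) / (t - of_nat r) * (\<Sum>v\<in>pverts D2. 1 / c))"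
    unfolding c_def t_def n1_def n2_def
    by (rule det_join)
      (use D reg join_denominators_nonzero row in
        \<open>simp_all only: c_def n1_def mult_minus1 minus_minus not_False_eq_True\<close>)
  \<comment> \<open>Out-regularity gives \<open>L(D\<^sub>1) = r I - A(D\<^sub>1)\<close>; the change of sign in front of \<open>A\<close> is the
     origin of the factor \<open>(-1)\<close> to the power \<open>n\<^sub>1\<close>.\<close>
  have "det_on (pverts D1) (char_entry (- 1) D1 (of_nat r - t)) =
      det_on (pverts D1) (\<lambda>u v. (- 1) * adj_char D1 t u v)"
    using reg by (intro det_on_cong[OF D1.pair_finite_verts])
      (auto simp: char_entry_def out_regular_def)
  then have sub: "det_on (pverts D1) (char_entry (- 1) D1 (of_nat r - t)) =
      (- 1) ^ n1 * det_on (pverts D1) (adj_char D1 t)"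
    by (simp only: det_on_scale[OF D1.pair_finite_verts] n1_def)
  have sq: "(- 1) ^ n1 * ((- 1) ^ n1 * z) = z" for z :: "complex poly fract"
    by (simp flip: mult.assoc power_mult_distrib)
  have one: "of_int (- 1) = (- 1 :: complex poly fract)" by simp
  show ?thesis
    unfolding subst_poly_lam[symmetric] laplacian_eq_signed subst_poly_charpoly[OF vs(1)]
      subst_poly_charpoly[OF vs(2)] subst_poly_charpoly[OF vs(3)] one of_nat_mult[symmetric]
      c_def[symmetric] t_def[symmetric] sub join
    using sq[of "det_on (pverts D1) (adj_char D1 t)"]
    by (simp add: n2_def ac_simps)
qed

lemma charpoly_signless_laplacian_join:
  assumes D: "simple_digraph D1" "simple_digraph D2" and reg: "out_regular r D1"
    and vs: "vertex_ordering vs1 D1" "vertex_ordering vs2 D2"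
      "vertex_ordering vs (subdivision_arc_join D1 D2)"
  defines "n1 \<equiv> card (pverts D1)" and "n2 \<equiv> card (pverts D2)"
  shows "to_fract (charpoly (signless_laplacian_matrix vs (subdivision_arc_join D1 D2))) =
       (lam - 1 - of_nat n2) powi (int n1 * (int r - 1))
       * subst_poly (charpoly (signless_laplacian_matrix vs2 D2)) (lam - of_nat n1 * of_nat r)
       * subst_poly (charpoly (signless_laplacian_matrix vs1 D1))
           (of_nat r + (lam - of_nat r) * (lam - 1 - of_nat n2))
       * (1 - (of_nat n1 * of_nat r * (lam - of_nat r)
                 * subst_ratfun (coronal (signless_laplacian_matrix vs2 D2))
                     (lam - of_nat n1 * of_nat r))
              / ((lam - of_nat r) * (lam - 1 - of_nat n2) - of_nat r))"
proof -
  interpret D1: pair_digraph D1 using D by (simp add: simple_digraph_def)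
  define t where "t = (lam - of_nat r) * (lam - 1 - of_nat n2)"
  define c where "c = lam - of_nat (n1 * r)"
  have one: "of_int 1 = (1 :: complex poly fract)" by simp
  obtain y where y: "\<And>u. u \<in> pverts D2 \<Longrightarrow> (\<Sum>v\<in>pverts D2. char_entry 1 D2 c u v * y v) = 1"
    and cor: "(\<Sum>v\<in>pverts D2. y v) = subst_ratfun (coronal (signed_matrix 1 vs2 D2)) c"
    using subst_coronal_as_solution[OF vs(2), of 1 "n1 * r"] unfolding c_def one by blast
  have join: "det_on (pverts (subdivision_arc_join D1 D2))
        (char_entry 1 (subdivision_arc_join D1 D2) lam) =
      (lam - 1 - of_nat n2) powi (int n1 * (int r - 1))
      * det_on (pverts D2) (char_entry 1 D2 c) * det_on (pverts D1) (adj_char D1 t)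
      * (1 - of_nat (n1 * r) * (lam - of_nat r) / (t - of_nat r) * (\<Sum>v\<in>pverts D2. y v))"
    unfolding c_def t_def n1_def n2_def
    by (rule det_join)
      (use D reg join_denominators_nonzero y in \<open>simp_all only: c_def n1_def mult_1_left not_False_eq_True\<close>)
  \<comment> \<open>Out-regularity gives \<open>Q(D\<^sub>1) = r I + A(D\<^sub>1)\<close>.\<close>
  have sub: "det_on (pverts D1) (char_entry 1 D1 (of_nat r + t)) =
      det_on (pverts D1) (adj_char D1 t)"
    using reg by (intro det_on_cong[OF D1.pair_finite_verts])
      (auto simp: char_entry_def out_regular_def)
  show ?thesis
    unfolding subst_poly_lam[symmetric] signless_laplacian_eq_signed subst_poly_charpoly[OF vs(1)]
      subst_poly_charpoly[OF vs(2)] subst_poly_charpoly[OF vs(3)] one of_nat_mult[symmetric]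
      c_def[symmetric] t_def[symmetric] sub join cor
    by simp
qed

lemma laplacian_spectrum_join_determined:
  assumes D: "simple_digraph D1" "simple_digraph D2" "out_regular r D1"
    and vs: "vertex_ordering vs1 D1" "vertex_ordering vs2 D2"
      "vertex_ordering vs (subdivision_arc_join D1 D2)"
    and D': "simple_digraph D1'" "simple_digraph D2'" "out_regular r' D1'"
    and vs': "vertex_ordering vs1' D1'" "vertex_ordering vs2' D2'"
      "vertex_ordering vs' (subdivision_arc_join D1' D2')"
    and spec: "spectrum_mset (laplacian_matrix vs1 D1) = spectrum_mset (laplacian_matrix vs1' D1')"
      "spectrum_mset (laplacian_matrix vs2 D2) = spectrum_mset (laplacian_matrix vs2' D2')"
  shows "spectrum_mset (laplacian_matrix vs (subdivision_arc_join D1 D2)) =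
    spectrum_mset (laplacian_matrix vs' (subdivision_arc_join D1' D2'))"
proof -
  note spec = spec[unfolded laplacian_eq_signed]
  have 1: "card (pverts D1) = card (pverts D1')" "r = r'"
    by (rule spectrum_determines_card[OF vs(1) vs'(1) spec(1)])
      (rule spectrum_determines_out_degree[OF D(1) D'(1) D(3) D'(3) vs(1) vs'(1) spec(1)])
  have 2: "card (pverts D2) = card (pverts D2')"
    by (rule spectrum_determines_card[OF vs(2) vs'(2) spec(2)])
  have "charpoly (laplacian_matrix vs1 D1) = charpoly (laplacian_matrix vs1' D1')"
    "charpoly (laplacian_matrix vs2 D2) = charpoly (laplacian_matrix vs2' D2')"
    unfolding laplacian_eq_signed charpoly_from_spectrum[OF signed_matrix_carrier] spec by simp_all
  then have "to_fract (charpoly (laplacian_matrix vs (subdivision_arc_join D1 D2))) =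
      to_fract (charpoly (laplacian_matrix vs' (subdivision_arc_join D1' D2')))"
    unfolding charpoly_laplacian_join[OF D vs] charpoly_laplacian_join[OF D' vs'] 1 2 by simp
  then show ?thesis by (simp add: spectrum_mset_def)
qed

lemma signless_laplacian_spectrum_join_determined:
  assumes D: "simple_digraph D1" "simple_digraph D2" "out_regular r D1"
    and vs: "vertex_ordering vs1 D1" "vertex_ordering vs2 D2"
      "vertex_ordering vs (subdivision_arc_join D1 D2)"
    and D': "simple_digraph D1'" "simple_digraph D2'" "out_regular r' D1'"
    and vs': "vertex_ordering vs1' D1'" "vertex_ordering vs2' D2'"
      "vertex_ordering vs' (subdivision_arc_join D1' D2')"
    and spec: "spectrum_mset (signless_laplacian_matrix vs1 D1) =
        spectrum_mset (signless_laplacian_matrix vs1' D1')"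
      "spectrum_mset (signless_laplacian_matrix vs2 D2) =
        spectrum_mset (signless_laplacian_matrix vs2' D2')"
    and cor: "coronal (signless_laplacian_matrix vs2 D2) =
        coronal (signless_laplacian_matrix vs2' D2')"
  shows "spectrum_mset (signless_laplacian_matrix vs (subdivision_arc_join D1 D2)) =
    spectrum_mset (signless_laplacian_matrix vs' (subdivision_arc_join D1' D2'))"
proof -
  note spec = spec[unfolded signless_laplacian_eq_signed]
  have 1: "card (pverts D1) = card (pverts D1')" "r = r'"
    by (rule spectrum_determines_card[OF vs(1) vs'(1) spec(1)])
      (rule spectrum_determines_out_degree[OF D(1) D'(1) D(3) D'(3) vs(1) vs'(1) spec(1)])
  have 2: "card (pverts D2) = card (pverts D2')"
    by (rule spectrum_determines_card[OF vs(2) vs'(2) spec(2)])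
  have "charpoly (signless_laplacian_matrix vs1 D1) = charpoly (signless_laplacian_matrix vs1' D1')"
    "charpoly (signless_laplacian_matrix vs2 D2) = charpoly (signless_laplacian_matrix vs2' D2')"
    unfolding signless_laplacian_eq_signed charpoly_from_spectrum[OF signed_matrix_carrier] spec
    by simp_all
  then have "to_fract (charpoly (signless_laplacian_matrix vs (subdivision_arc_join D1 D2))) =
      to_fract (charpoly (signless_laplacian_matrix vs' (subdivision_arc_join D1' D2')))"
    unfolding charpoly_signless_laplacian_join[OF D vs] charpoly_signless_laplacian_join[OF D' vs']
      1 2 cor by simp
  then show ?thesis by (simp add: spectrum_mset_def)
qed

theorem theorem4p9:
  fixes D1 :: "'a pair_pre_digraph" and D2 :: "'b pair_pre_digraph"
    and n1 n2 m1 m2 r :: nat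
    and vs1 :: "'a list" and vs2 :: "'b list" and vs :: "(('a + 'a \<times> 'a) + 'b) list"
  assumes "simple_digraph D1" and "simple_digraph D2"
    and "card (pverts D1) = n1" and "card (pverts D2) = n2"
    and "card (parcs D1) = m1" and "card (parcs D2) = m2"
    and "out_regular r D1"
    and "vertex_ordering vs1 D1" and "vertex_ordering vs2 D2"
    and "vertex_ordering vs (subdivision_arc_join D1 D2)"
  shows
    "(to_fract (charpoly (laplacian_matrix vs (subdivision_arc_join D1 D2))) =
       (-1) ^ n1
       * (lam - 1 - of_nat n2) powi (int n1 * (int r - 1))
       * subst_poly (charpoly (laplacian_matrix vs2 D2)) (lam - of_nat n1 * of_nat r)
       * subst_poly (charpoly (laplacian_matrix vs1 D1))
           (of_nat r - (lam - of_nat r) * (lam - 1 - of_nat n2))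
       * (1 - (of_nat r * (lam - of_nat r) * of_nat n1 * of_nat n2)
              / ((lam - of_nat n1 * of_nat r)
                 * ((lam - of_nat r) * (lam - 1 - of_nat n2) - of_nat r))))
     \<and> (to_fract (charpoly (signless_laplacian_matrix vs (subdivision_arc_join D1 D2))) =
       (lam - 1 - of_nat n2) powi (int n1 * (int r - 1))
       * subst_poly (charpoly (signless_laplacian_matrix vs2 D2)) (lam - of_nat n1 * of_nat r)
       * subst_poly (charpoly (signless_laplacian_matrix vs1 D1))
           (of_nat r + (lam - of_nat r) * (lam - 1 - of_nat n2))
       * (1 - (of_nat n1 * of_nat r * (lam - of_nat r)
                 * subst_ratfun (coronal (signless_laplacian_matrix vs2 D2))
                     (lam - of_nat n1 * of_nat r))
              / ((lam - of_nat r) * (lam - 1 - of_nat n2) - of_nat r)))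
     \<and> (\<forall>(D1' :: 'c pair_pre_digraph) (D2' :: 'd pair_pre_digraph) r' vs1' vs2' vs'.
       simple_digraph D1' \<longrightarrow> simple_digraph D2' \<longrightarrow> out_regular r' D1' \<longrightarrow>
       vertex_ordering vs1' D1' \<longrightarrow> vertex_ordering vs2' D2' \<longrightarrow>
       vertex_ordering vs' (subdivision_arc_join D1' D2') \<longrightarrow>
       spectrum_mset (laplacian_matrix vs1 D1) = spectrum_mset (laplacian_matrix vs1' D1') \<longrightarrow>
       spectrum_mset (laplacian_matrix vs2 D2) = spectrum_mset (laplacian_matrix vs2' D2') \<longrightarrow>
       spectrum_mset (laplacian_matrix vs (subdivision_arc_join D1 D2)) =
         spectrum_mset (laplacian_matrix vs' (subdivision_arc_join D1' D2')))
     \<and> (\<forall>(D1' :: 'c pair_pre_digraph) (D2' :: 'd pair_pre_digraph) r' vs1' vs2' vs'.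
       simple_digraph D1' \<longrightarrow> simple_digraph D2' \<longrightarrow> out_regular r' D1' \<longrightarrow>
       vertex_ordering vs1' D1' \<longrightarrow> vertex_ordering vs2' D2' \<longrightarrow>
       vertex_ordering vs' (subdivision_arc_join D1' D2') \<longrightarrow>
       spectrum_mset (signless_laplacian_matrix vs1 D1) =
         spectrum_mset (signless_laplacian_matrix vs1' D1') \<longrightarrow>
       spectrum_mset (signless_laplacian_matrix vs2 D2) =
         spectrum_mset (signless_laplacian_matrix vs2' D2') \<longrightarrow>
       coronal (signless_laplacian_matrix vs2 D2) = coronal (signless_laplacian_matrix vs2' D2') \<longrightarrow>
       spectrum_mset (signless_laplacian_matrix vs (subdivision_arc_join D1 D2)) =
         spectrum_mset (signless_laplacian_matrix vs' (subdivision_arc_join D1' D2')))"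
proof -
  note D = assms(1,2,7) and vs = assms(8-10)
  show ?thesis
  proof (intro conjI allI impI, goal_cases)
    case 1
    show ?case using charpoly_laplacian_join[OF D vs] by (simp only: assms(3,4))
  next
    case 2
    show ?case using charpoly_signless_laplacian_join[OF D vs] by (simp only: assms(3,4))
  next
    case (3 D1' D2' r' vs1' vs2' vs')
    then show ?case by (intro laplacian_spectrum_join_determined[OF D vs])
  next
    case (4 D1' D2' r' vs1' vs2' vs')
    then show ?case by (intro signless_laplacian_spectrum_join_determined[OF D vs])
  qed
qed

end
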